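(* Let $N:L^2(D^c,\mu(x)dx)\to L^2(D^c,\mu(x)dx)$ be the Dirichlet-to-Neumann operator. For every $\phi\in L^2(D^c,\mu(x)dx)$, with $u$ the solution of the exterior value Dirichlet problem with exterior data $\phi$, $$N\phi=\widetilde{\mathcal{N}}u\quad\text{in }L^2(D^c,\mu(x)dx).$$
   Context: Setting. Let $d\ge 2$ and let $j:(0,\infty)\to(0,\infty)$ be non-increasing with $\int_{\mathbb{R}^d}(1\wedge|x|^2)\,j(|x|)\,dx<\infty$. Put $k(x,y):=j(|x-y|)$. Let $D\subset\mathbb{R}^d$ be a bounded open set whose boundary $\partial D$ has Lebesgue measure zero; $D^c=\mathbb{R}^d\setminus D$, $\overline D^c=\mathbb{R}^d\setminus\overline D$. All functions are measurable and identified when equal a.e. For $u,v:\mathbb{R}^d\to\mathbb{R}$ let $$\widehat{\mathcal{E}}(u,v):=\frac12\iint_{(\mathbb{R}^d\times\mathbb{R}^d)\setminus(D^c\times D^c)}(u(x)-u(y))(v(x)-v(y))k(x,y)\,dy\,dx ,$$ $V^{k,2}(D):=\{u:\mathbb{R}^d\to\mathbb{R}:\ u|_D\in L^2(D),\ \widehat{\mathcal{E}}(u,u)<\infty\}$ and $V^{k,2}_D(D):=\{u\in V^{k,2}(D):u=0\text{ a.e. on }D^c\}$. For $x\in D^c$ let $\mu(x):=\int_Dk(x,y)\,dy$ (finite on $\overline D^c$). The space $L^2(D^c,\mu(x)dx)$ has inner product $(\phi,\chi)=\int_{D^c}\phi(x)\chi(x)\mu(x)\,dx$; functions in it are extended to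 $\mathbb{R}^d$ by $0$ on $D$. Exterior value Dirichlet problem. Given $\phi\in L^2(D^c,\mu(x)dx)$, the solution with exterior data $\phi$ is the function $u\in V^{k,2}(D)$ such that $u-\phi\in V^{k,2}_D(D)$ and $\widehat{\mathcal{E}}(u,w)=0$ for all $w\in V^{k,2}_D(D)$; it is known to exist and to be unique. Dirichlet-to-Neumann operator. $N$ is the bounded linear operator on $L^2(D^c,\mu(x)dx)$ determined by $(N\phi,\chi)_{L^2(D^c,\mu(x)dx)}=\widehat{\mathcal{E}}(u,v)$ for all $\phi,\chi\in L^2(D^c,\mu(x)dx)$, where $u,v$ are the solutions of the exterior value Dirichlet problem with data $\phi,\chi$. Normalized non-local normal derivative: for $x\in\overline D^c$, $$\widetilde{\mathcal{N}}u(x):=\frac{\int_D(u(x)-u(y))k(x,y)\,dy}{\int_Dk(x,y)\,dy}.$$ *)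

theory Defs
  imports "HOL-Analysis.Analysis"
begin

text \<open>
  Functions are Borel representatives of their a.e. classes, and identities between them are
  a.e. statements. The value of \<open>j\<close> at \<open>0\<close> is irrelevant: it only enters on the
  diagonal, which is a null set.
\<close>

definition jump_kernel :: "(real \<Rightarrow> real) \<Rightarrow> 'a::euclidean_space \<Rightarrow> 'a \<Rightarrow> real" where
  "jump_kernel j x y = j (norm (x - y))"

definition energy_density ::
    "(real \<Rightarrow> real) \<Rightarrow> ('a::euclidean_space \<Rightarrow> real) \<Rightarrow> ('a \<Rightarrow> real) \<Rightarrow> 'a \<times> 'a \<Rightarrow> real" where
  "energy_density j u v = (\<lambda>(x, y). (u x - u y) * (v x - v y) * jump_kernel j x y)"

definition energy_form ::
    "(real \<Rightarrow> real) \<Rightarrow> 'a::euclidean_space set \<Rightarrow> ('a \<Rightarrow> real) \<Rightarrow> ('a \<Rightarrow> real) \<Rightarrow> real" where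
  "energy_form j D u v =
     1 / 2 * (LINT p : (UNIV - (- D) \<times> (- D)) | (lborel \<Otimes>\<^sub>M lborel). energy_density j u v p)"

text \<open>
  The integrands \<open>(u x)\<^sup>2\<close> and \<open>energy_density j u u\<close> are nonnegative and measurable,
  so integrability says exactly that the integral is finite.
\<close>

definition energy_space ::
    "(real \<Rightarrow> real) \<Rightarrow> 'a::euclidean_space set \<Rightarrow> ('a \<Rightarrow> real) set" where
  "energy_space j D = {u \<in> borel_measurable borel.
     set_integrable lborel D (\<lambda>x. (u x)\<^sup>2) \<and>
     set_integrable (lborel \<Otimes>\<^sub>M lborel) (UNIV - (- D) \<times> (- D)) (energy_density j u u)}"

definition energy_space_zero ::
    "(real \<Rightarrow> real) \<Rightarrow> 'a::euclidean_space set \<Rightarrow> ('a \<Rightarrow> real) set" where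
  "energy_space_zero j D =
     {u \<in> energy_space j D. AE x in lborel. x \<in> - D \<longrightarrow> u x = 0}"

definition exterior_weight ::
    "(real \<Rightarrow> real) \<Rightarrow> 'a::euclidean_space set \<Rightarrow> 'a \<Rightarrow> ennreal" where
  "exterior_weight j D x = (\<integral>\<^sup>+ y \<in> D. ennreal (jump_kernel j x y) \<partial>lborel)"

text \<open>The measure \<open>\<mu>(x) dx\<close> on the complement of \<open>D\<close>, as a measure on the whole space.\<close>

definition exterior_measure ::
    "(real \<Rightarrow> real) \<Rightarrow> 'a::euclidean_space set \<Rightarrow> 'a measure" where
  "exterior_measure j D = density lborel (\<lambda>x. exterior_weight j D x * indicator (- D) x)"

text \<open>Elements of \<open>L\<^sup>2(D\<^sup>c, \<mu>(x) dx)\<close>, extended by \<open>0\<close> to \<open>D\<close>.\<close>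

definition exterior_L2 ::
    "(real \<Rightarrow> real) \<Rightarrow> 'a::euclidean_space set \<Rightarrow> ('a \<Rightarrow> real) set" where
  "exterior_L2 j D = {\<phi> \<in> borel_measurable borel.
     (\<forall>x\<in>D. \<phi> x = 0) \<and> integrable (exterior_measure j D) (\<lambda>x. (\<phi> x)\<^sup>2)}"

definition exterior_inner ::
    "(real \<Rightarrow> real) \<Rightarrow> 'a::euclidean_space set \<Rightarrow> ('a \<Rightarrow> real) \<Rightarrow> ('a \<Rightarrow> real) \<Rightarrow> real" where
  "exterior_inner j D \<phi> \<psi> = (LINT x | exterior_measure j D. \<phi> x * \<psi> x)"

definition exterior_norm ::
    "(real \<Rightarrow> real) \<Rightarrow> 'a::euclidean_space set \<Rightarrow> ('a \<Rightarrow> real) \<Rightarrow> real" where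
  "exterior_norm j D \<phi> = sqrt (exterior_inner j D \<phi> \<phi>)"

definition exterior_eq ::
    "(real \<Rightarrow> real) \<Rightarrow> 'a::euclidean_space set \<Rightarrow> ('a \<Rightarrow> real) \<Rightarrow> ('a \<Rightarrow> real) \<Rightarrow> bool" where
  "exterior_eq j D \<phi> \<psi> \<longleftrightarrow>
     \<phi> \<in> exterior_L2 j D \<and> \<psi> \<in> exterior_L2 j D \<and> (AE x in exterior_measure j D. \<phi> x = \<psi> x)"

definition dirichlet_solution ::
    "(real \<Rightarrow> real) \<Rightarrow> 'a::euclidean_space set \<Rightarrow> ('a \<Rightarrow> real) \<Rightarrow> ('a \<Rightarrow> real) \<Rightarrow> bool" where
  "dirichlet_solution j D \<phi> u \<longleftrightarrow>
     u \<in> energy_space j D \<and>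
     (\<lambda>x. u x - \<phi> x) \<in> energy_space_zero j D \<and>
     (\<forall>w \<in> energy_space_zero j D. energy_form j D u w = 0)"

text \<open>
  The first clause makes \<open>N\<close> a map on a.e. classes (take \<open>\<psi> = \<phi>\<close> for \<open>N \<phi>\<close> to lie in the space).
\<close>

definition dirichlet_to_neumann ::
    "(real \<Rightarrow> real) \<Rightarrow> 'a::euclidean_space set \<Rightarrow> (('a \<Rightarrow> real) \<Rightarrow> ('a \<Rightarrow> real)) \<Rightarrow> bool" where
  "dirichlet_to_neumann j D N \<longleftrightarrow>
     (\<forall>\<phi> \<psi>. exterior_eq j D \<phi> \<psi> \<longrightarrow> exterior_eq j D (N \<phi>) (N \<psi>)) \<and>
     (\<forall>\<phi> \<in> exterior_L2 j D. \<forall>\<psi> \<in> exterior_L2 j D.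
        exterior_eq j D (N (\<lambda>x. \<phi> x + \<psi> x)) (\<lambda>x. N \<phi> x + N \<psi> x)) \<and>
     (\<forall>c. \<forall>\<phi> \<in> exterior_L2 j D. exterior_eq j D (N (\<lambda>x. c * \<phi> x)) (\<lambda>x. c * N \<phi> x)) \<and>
     (\<exists>C. \<forall>\<phi> \<in> exterior_L2 j D. exterior_norm j D (N \<phi>) \<le> C * exterior_norm j D \<phi>) \<and>
     (\<forall>\<phi> \<in> exterior_L2 j D. \<forall>\<psi> \<in> exterior_L2 j D. \<forall>u v.
        dirichlet_solution j D \<phi> u \<longrightarrow> dirichlet_solution j D \<psi> v \<longrightarrow>
        exterior_inner j D (N \<phi>) \<psi> = energy_form j D u v)"

text \<open>
  The normal derivative lives on the complement of the closure of \<open>D\<close>. The value \<open>0\<close> elsewhere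
  is the extension by \<open>0\<close> on \<open>D\<close>; the boundary of \<open>D\<close> is a null set.
\<close>

definition normal_derivative ::
    "(real \<Rightarrow> real) \<Rightarrow> 'a::euclidean_space set \<Rightarrow> ('a \<Rightarrow> real) \<Rightarrow> 'a \<Rightarrow> real" where
  "normal_derivative j D u x =
     (if x \<in> - closure D
      then (LINT y : D | lborel. (u x - u y) * jump_kernel j x y)
             / (LINT y : D | lborel. jump_kernel j x y)
      else 0)"

end

theory Submission
  imports Defs
begin

text \<open>
  An element \<open>\<eta>\<close> of \<open>L\<^sup>2(D\<^sup>c, \<mu>(x) dx)\<close>, extended by \<open>0\<close>, already lies in the energy space, because
  \<open>(\<eta>(x) - \<eta>(y))\<^sup>2\<close> integrates to \<open>2 \<integral> \<eta>\<^sup>2 d\<mu>\<close> over the pairs that meet \<open>D\<close>. Hence the solution with data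
  \<open>\<eta>\<close> can replace \<open>\<eta>\<close> as test function without changing its energy against \<open>u\<close>, and Fubini gives
  \<open>(N \<phi>, \<eta>) = E(u, \<eta>) = \<integral> \<eta>(x) \<integral>\<^sub>D (u(x) - u(y)) k(x, y) dy dx\<close>. The normal derivative is square
  integrable by Jensen's inequality, so \<open>\<eta> = N \<phi> - \<N> u\<close> is an admissible choice and must vanish.

  The solution with data \<open>\<eta>\<close> exists by minimising the energy over \<open>\<eta> + w\<close> with \<open>w\<close> vanishing
  outside \<open>D\<close>; a minimising sequence converges a.e. thanks to the Poincare inequality.
\<close>

section \<open>Orthogonal projection in the space of square integrable functions\<close>

lemma integrable_mult_of_squares:
  fixes f g :: "'a \<Rightarrow> real"
  assumes [measurable]: "f \<in> borel_measurable M" "g \<in> borel_measurable M"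
    and "integrable M (\<lambda>x. (f x)\<^sup>2)" "integrable M (\<lambda>x. (g x)\<^sup>2)"
  shows "integrable M (\<lambda>x. f x * g x)"
proof (rule Bochner_Integration.integrable_bound)
  show "integrable M (\<lambda>x. (f x)\<^sup>2 + (g x)\<^sup>2)"
    using assms by auto
  have "\<bar>a * b\<bar> \<le> a\<^sup>2 + b\<^sup>2" for a b :: real
  proof -
    have "2 * (\<bar>a\<bar> * \<bar>b\<bar>) \<le> a\<^sup>2 + b\<^sup>2"
      using sum_squares_bound[of "\<bar>a\<bar>" "\<bar>b\<bar>"] by (simp add: mult.assoc)
    moreover have "0 \<le> \<bar>a\<bar> * \<bar>b\<bar>"
      by simp
    ultimately show ?thesis
      unfolding abs_mult by linarith
  qed
  then show "AE x in M. norm (f x * g x) \<le> norm ((f x)\<^sup>2 + (g x)\<^sup>2)"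
    by (simp add: abs_mult)
qed simp

lemma integrable_square_add:
  fixes f g :: "'a \<Rightarrow> real"
  assumes "f \<in> borel_measurable M" "g \<in> borel_measurable M"
    and "integrable M (\<lambda>x. (f x)\<^sup>2)" "integrable M (\<lambda>x. (g x)\<^sup>2)"
  shows "integrable M (\<lambda>x. (f x + g x)\<^sup>2)"
  using assms integrable_mult_of_squares[OF assms]
  by (simp add: power2_sum mult.assoc)

text \<open>The decay \<open>(1/4)^n\<close> is split in two: after multiplication by
  \<open>2^n\<close> the squared increments still have summable integrals, so a.e.
  \<open>2^n * (f (Suc n) x - f n x)\<^sup>2\<close> is bounded in \<open>n\<close>. The increments
  then decay like \<open>(sqrt (1/2))^n\<close>, and telescoping gives a limit for the whole
  sequence, without passing to a subsequence.\<close>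

lemma AE_convergent_of_fast_L2_Cauchy:
  fixes f :: "nat \<Rightarrow> 'a \<Rightarrow> real"
  assumes [measurable]: "\<And>n. f n \<in> borel_measurable M"
    and le: "\<And>n. (\<integral>\<^sup>+ x. ennreal ((f (Suc n) x - f n x)\<^sup>2) \<partial>M) \<le> ennreal (C * (1/4)^n)"
    and "C \<ge> 0"
  shows "AE x in M. convergent (\<lambda>n. f n x)"
proof -
  let ?g = "\<lambda>n x. 2^n * (f (Suc n) x - f n x)\<^sup>2"
  have "(\<integral>\<^sup>+ x. (\<Sum>n. ennreal (?g n x)) \<partial>M) = (\<Sum>n. \<integral>\<^sup>+ x. ennreal (?g n x) \<partial>M)"
    by (rule nn_integral_suminf) simp
  also have "\<dots> \<le> (\<Sum>n. ennreal (C * (1/2)^n))"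
  proof (rule suminf_le)
    fix n
    have "(\<integral>\<^sup>+ x. ennreal (?g n x) \<partial>M) = ennreal (2^n) * (\<integral>\<^sup>+ x. ennreal ((f (Suc n) x - f n x)\<^sup>2) \<partial>M)"
      by (subst nn_integral_cmult[symmetric]) (auto simp: ennreal_mult)
    also have "\<dots> \<le> ennreal (2^n) * ennreal (C * (1/4)^n)"
      using le by (intro mult_left_mono) auto
    also have "\<dots> = ennreal (C * (1/2)^n)"
    proof -
      have "2^n * (C * (1/4)^n) = C * (1/2::real)^n"
        by (simp add: power_mult_distrib[symmetric] mult.left_commute)
      then show ?thesis
        using \<open>C \<ge> 0\<close> by (simp add: ennreal_mult[symmetric])
    qed
    finally show "(\<integral>\<^sup>+ x. ennreal (?g n x) \<partial>M) \<le> ennreal (C * (1/2)^n)" .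
  qed auto
  also have "\<dots> < \<infinity>"
    using \<open>C \<ge> 0\<close> by (subst suminf_ennreal2) (auto intro!: summable_mult summable_geometric)
  finally have "AE x in M. (\<Sum>n. ennreal (?g n x)) \<noteq> \<infinity>"
    by (intro nn_integral_PInf_AE) auto
  then show ?thesis
  proof eventually_elim
    case (elim x)
    then have "summable (\<lambda>n. ?g n x)"
      by (intro summable_suminf_not_top) (auto simp: top_ennreal_def[symmetric])
    then have "(\<lambda>n. ?g n x) \<longlonglongrightarrow> 0"
      by (rule summable_LIMSEQ_zero)
    then have "Bseq (\<lambda>n. ?g n x)"
      by (intro convergent_imp_Bseq convergentI)
    then obtain B where B: "\<And>n. \<bar>?g n x\<bar> \<le> B"
      unfolding Bseq_def by auto
    have le: "\<bar>f (Suc n) x - f n x\<bar> \<le> sqrt B * (sqrt (1/2))^n" for n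
    proof -
      have "(f (Suc n) x - f n x)\<^sup>2 \<le> B * (1/2)^n"
        using B[of n] by (simp add: field_simps power_divide)
      then have "sqrt ((f (Suc n) x - f n x)\<^sup>2) \<le> sqrt (B * (1/2)^n)"
        by (rule real_sqrt_le_mono)
      then show ?thesis
        by (simp only: real_sqrt_abs real_sqrt_mult real_sqrt_power[of "1/2"])
    qed
    have "summable (\<lambda>n. sqrt B * (sqrt (1/2))^n)"
      by (intro summable_mult summable_geometric) simp
    then have "summable (\<lambda>n. f (Suc n) x - f n x)"
      by (rule summable_comparison_test'[where N = 0]) (unfold real_norm_def, rule le)
    then have "convergent (\<lambda>n. \<Sum>i<n. f (Suc i) x - f i x)"
      by (simp add: summable_iff_convergent)
    then have "convergent (\<lambda>n. f n x - f 0 x)"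
      using sum_lessThan_telescope[of "\<lambda>n. f n x"] by simp
    then show ?case
      using convergent_add[OF _ convergent_const[of "f 0 x"]] by fastforce
  qed
qed

text \<open>The function \<open>f\<close> found here is minus the orthogonal projection of
  \<open>g\<close> onto \<open>S\<close>, obtained by minimising the squared norm of
  \<open>g + f\<close>. Completeness enters only through \<open>closed\<close>, which asks for a.e.
  limits of rapidly converging bounded sequences; for increments of functions this is easier to
  verify than norm closedness.\<close>

lemma L2_orthogonal_projection:
  fixes S :: "('a \<Rightarrow> real) set"
  assumes meas: "\<And>f. f \<in> S \<Longrightarrow> f \<in> borel_measurable M"
    and sq: "\<And>f. f \<in> S \<Longrightarrow> integrable M (\<lambda>x. (f x)\<^sup>2)"
    and zero: "(\<lambda>x. 0) \<in> S"
    and add: "\<And>f h. f \<in> S \<Longrightarrow> h \<in> S \<Longrightarrow> (\<lambda>x. f x + h x) \<in> S"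
    and scale: "\<And>f c. f \<in> S \<Longrightarrow> (\<lambda>x. c * f x) \<in> S"
    and closed: "\<And>F B. (\<And>n. F n \<in> S) \<Longrightarrow>
        (\<And>n. (LINT x|M. (F (Suc n) x - F n x)\<^sup>2) \<le> (1/4)^n) \<Longrightarrow>
        (\<And>n. (LINT x|M. (F n x)\<^sup>2) \<le> B) \<Longrightarrow>
        \<exists>f\<in>S. AE x in M. (\<lambda>n. F n x) \<longlonglongrightarrow> f x"
    and g: "g \<in> borel_measurable M" "integrable M (\<lambda>x. (g x)\<^sup>2)"
  shows "\<exists>f\<in>S. \<forall>h\<in>S. (LINT x|M. (g x + f x) * h x) = 0"
proof -
  define a where "a f = (LINT x|M. (g x + f x)\<^sup>2)" for f
  define m where "m = Inf (a ` S)"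
  have a_int: "integrable M (\<lambda>x. (g x + f x)\<^sup>2)" if "f \<in> S" for f
    using that by (intro integrable_square_add g meas sq)
  have a_meas: "(\<lambda>x. g x + f x) \<in> borel_measurable M" if "f \<in> S" for f
    using that g meas by auto
  have bdd: "bdd_below (a ` S)"
    by (intro bdd_belowI2[of _ 0]) (auto simp: a_def)
  have m_le: "m \<le> a f" if "f \<in> S" for f
    unfolding m_def using bdd that by (simp add: cInf_lower)
  \<comment> \<open>With this excess the parallelogram law bounds consecutive squared distances by
    four times \<open>(1/4)^n / 4\<close>, exactly the rate in \<open>closed\<close>.\<close>
  have "\<exists>f\<in>S. a f < m + (1/4)^n / 4" for n
  proof -
    have "Inf (a ` S) < m + (1/4)^n / 4"
      by (simp add: m_def)
    moreover have "a ` S \<noteq> {}"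
      using zero by auto
    ultimately obtain y where "y \<in> a ` S" "y < m + (1/4)^n / 4"
      using cInf_lessD[of "a ` S"] by meson
    then show ?thesis
      by auto
  qed
  then obtain F where F: "\<And>n. F n \<in> S" "\<And>n. a (F n) < m + (1/4)^n / 4"
    by metis
  have "(LINT x|M. (F (Suc n) x - F n x)\<^sup>2) \<le> (1/4)^n" for n
  proof -
    \<comment> \<open>Parallelogram law for the translates by \<open>g\<close> of \<open>F n\<close> and \<open>F (Suc n)\<close>.\<close>
    define mid where "mid = (\<lambda>x. (1/2) * (F (Suc n) x + F n x))"
    have mid: "mid \<in> S"
      unfolding mid_def by (intro scale add F)
    have "(LINT x|M. (F (Suc n) x - F n x)\<^sup>2)
        = (LINT x|M. 2 * (g x + F (Suc n) x)\<^sup>2 + 2 * (g x + F n x)\<^sup>2 - 4 * (g x + mid x)\<^sup>2)"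
      by (intro Bochner_Integration.integral_cong refl) (simp add: mid_def power2_eq_square algebra_simps)
    also have "\<dots> = 2 * a (F (Suc n)) + 2 * a (F n) - 4 * a mid"
      using a_int[OF F(1)[of n]] a_int[OF F(1)[of "Suc n"]] a_int[OF mid] by (simp add: a_def)
    also have "\<dots> \<le> 2 * (m + (1/4)^n / 4) + 2 * (m + (1/4)^n / 4) - 4 * m"
    proof -
      have "(1/4::real)^Suc n \<le> (1/4)^n"
        by simp
      then have "a (F (Suc n)) \<le> m + (1/4)^n / 4"
        using F(2)[of "Suc n"] by linarith
      moreover have "2 * r + 2 * s - 4 * t \<le> 2 * q + 2 * q - 4 * m"
        if "r \<le> q" "s \<le> q" "m \<le> t" for r s t q :: real
        using that by argo
      ultimately show ?thesis
        using less_imp_le[OF F(2)[of n]] m_le[OF mid] by blast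
    qed
    finally show ?thesis
      by simp
  qed
  \<comment> \<open>The uniform bound required by \<open>closed\<close>: write \<open>F n\<close> as
    \<open>(g + F n) - g\<close>, where the first term has squared norm at most
    \<open>m + 1\<close>.\<close>
  moreover have "(LINT x|M. (F n x)\<^sup>2) \<le> 2 * (m + 1) + 2 * (LINT x|M. (g x)\<^sup>2)" for n
  proof -
    have "(LINT x|M. (F n x)\<^sup>2) \<le> (LINT x|M. 2 * (g x + F n x)\<^sup>2 + 2 * (g x)\<^sup>2)"
    proof (intro integral_mono sq F)
      show "integrable M (\<lambda>x. 2 * (g x + F n x)\<^sup>2 + 2 * (g x)\<^sup>2)"
        using a_int[OF F(1)] g(2) by simp
      have "b\<^sup>2 \<le> 2 * (c + b)\<^sup>2 + 2 * c\<^sup>2" for b c :: real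
        using zero_le_power2[of "b + 2 * c"] by (simp add: power2_eq_square algebra_simps)
      then show "(F n x)\<^sup>2 \<le> 2 * (g x + F n x)\<^sup>2 + 2 * (g x)\<^sup>2" for x .
    qed
    also have "\<dots> = 2 * a (F n) + 2 * (LINT x|M. (g x)\<^sup>2)"
      using a_int[OF F(1)] g(2) by (simp add: a_def)
    also have "(1/4::real)^n \<le> 1"
      by (simp add: power_le_one)
    then have "a (F n) \<le> m + 1"
      using F(2)[of n] by linarith
    finally show ?thesis
      by simp
  qed
  ultimately have "\<exists>f\<in>S. AE x in M. (\<lambda>n. F n x) \<longlonglongrightarrow> f x"
    by (rule closed[OF F(1)])
  then obtain f where f: "f \<in> S" and lim: "AE x in M. (\<lambda>n. F n x) \<longlonglongrightarrow> f x"
    by blast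
  \<comment> \<open>Only a.e. convergence is known, so Fatou's lemma is what shows that the limit
    attains the infimum.\<close>
  have "ennreal (a f) = (\<integral>\<^sup>+ x. ennreal ((g x + f x)\<^sup>2) \<partial>M)"
    unfolding a_def using a_int[OF f] by (intro nn_integral_eq_integral[symmetric]) auto
  also have "\<dots> = (\<integral>\<^sup>+ x. liminf (\<lambda>n. ennreal ((g x + F n x)\<^sup>2)) \<partial>M)"
  proof (intro nn_integral_cong_AE, use lim in eventually_elim)
    case (elim x)
    then have "(\<lambda>n. ennreal ((g x + F n x)\<^sup>2)) \<longlonglongrightarrow> ennreal ((g x + f x)\<^sup>2)"
      by (intro tendsto_intros)
    then show ?case
      by (rule lim_imp_Liminf[OF trivial_limit_sequentially, symmetric])
  qed
  also have "\<dots> \<le> liminf (\<lambda>n. \<integral>\<^sup>+ x. ennreal ((g x + F n x)\<^sup>2) \<partial>M)"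
    using a_meas[OF F(1)] by (intro nn_integral_liminf) auto
  also have "\<dots> = liminf (\<lambda>n. ennreal (a (F n)))"
    unfolding a_def using a_int[OF F(1)] by (subst nn_integral_eq_integral) auto
  also have "\<dots> \<le> liminf (\<lambda>n. ennreal (m + (1/4)^n / 4))"
    using F(2) by (intro Liminf_mono always_eventually allI ennreal_leI less_imp_le)
  also have "\<dots> = ennreal m"
  proof -
    have "(\<lambda>n. ennreal (m + (1/4)^n / 4)) \<longlonglongrightarrow> ennreal (m + 0 / 4)"
      by (intro tendsto_intros LIMSEQ_power_zero) auto
    then show ?thesis
      by (simp add: lim_imp_Liminf)
  qed
  finally have "ennreal (a f) \<le> ennreal m" .
  moreover have "0 \<le> m"
    unfolding m_def using zero by (intro cInf_greatest) (auto simp: a_def)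
  ultimately have "a f \<le> m"
    by simp
  show ?thesis
  proof (intro bexI[OF _ f] ballI)
    fix h assume h: "h \<in> S"
    define b where "b = (LINT x|M. (g x + f x) * h x)"
    define c where "c = (LINT x|M. (h x)\<^sup>2)"
    have gh: "integrable M (\<lambda>x. (g x + f x) * h x)"
      using h f by (intro integrable_mult_of_squares a_meas a_int meas sq)
    \<comment> \<open>First variation: the minimiser \<open>f\<close> is compared with
      \<open>f + t h\<close>.\<close>
    have quad: "0 \<le> 2 * t * b + t\<^sup>2 * c" for t
    proof -
      have "m \<le> a (\<lambda>x. f x + t * h x)"
        by (intro m_le add scale f h)
      also have "\<dots> = (LINT x|M. (g x + f x)\<^sup>2 + (2 * t) * ((g x + f x) * h x) + t\<^sup>2 * (h x)\<^sup>2)"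
        unfolding a_def
        by (intro Bochner_Integration.integral_cong refl) (simp add: power2_eq_square algebra_simps)
      also have "\<dots> = a f + 2 * t * b + t\<^sup>2 * c"
        using a_int[OF f] gh sq[OF h] by (simp add: a_def b_def c_def)
      finally show ?thesis
        using \<open>a f \<le> m\<close> by simp
    qed
    have "c \<ge> 0"
      by (simp add: c_def)
    \<comment> \<open>The quadratic would be minimal at \<open>t = - b / c\<close>, but
      \<open>c\<close> may be 0. Taking \<open>t = - b / (c + 1)\<close> avoids the division by zero
      and still gives a negative value unless \<open>b = 0\<close>.\<close>
    define s where "s = 1 / (c + 1)"
    have "s > 0" and sc: "s * c = 1 - s"
      using \<open>c \<ge> 0\<close> by (auto simp: s_def field_simps)
    have "0 \<le> 2 * (- b * s) * b + (- b * s)\<^sup>2 * c"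
      by (rule quad)
    also have "\<dots> = - 2 * b\<^sup>2 * s + b\<^sup>2 * s * (s * c)"
      by (simp add: power2_eq_square)
    also have "\<dots> = - (b\<^sup>2 * (s + s\<^sup>2))"
      unfolding sc by (simp add: power2_eq_square algebra_simps)
    finally have "b\<^sup>2 * (s + s\<^sup>2) \<le> 0"
      by simp
    moreover have "0 < s + s\<^sup>2"
      using \<open>s > 0\<close> by (simp add: add_pos_pos)
    ultimately have "b = 0"
      by (auto simp: mult_le_0_iff)
    then show "(LINT x|M. (g x + f x) * h x) = 0"
      by (simp add: b_def)
  qed
qed

section \<open>The energy as an integral over pairs\<close>

text \<open>Passing from \<open>u\<close> to its increments turns the energy into half a squared L2
  norm over pairs, so that Hilbert space arguments apply.\<close>

definition increment :: "('a \<Rightarrow> real) \<Rightarrow> 'a \<times> 'a \<Rightarrow> real" where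
  "increment u p = u (fst p) - u (snd p)"

lemma indicator_power2: "(indicator A x :: real)\<^sup>2 = indicator A x"
  by (simp add: indicator_def)

lemma increment_add: "increment (\<lambda>x. u x + v x) = (\<lambda>p. increment u p + increment v p)"
  by (auto simp: increment_def)

lemma increment_diff: "increment (\<lambda>x. u x - v x) = (\<lambda>p. increment u p - increment v p)"
  by (auto simp: increment_def)

lemma increment_scale: "increment (\<lambda>x. c * u x) = (\<lambda>p. c * increment u p)"
  by (auto simp: increment_def algebra_simps)

lemma measurable_increment [measurable]:
  assumes [measurable]: "u \<in> borel_measurable borel"
  shows "increment u \<in> borel_measurable (lborel \<Otimes>\<^sub>M lborel)"
  unfolding increment_def[abs_def] by measurable

lemma AE_lborel_pair_fst_snd:
  fixes P :: "'a::euclidean_space \<Rightarrow> bool"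
  assumes "AE x in lborel. P x"
  shows "AE p in lborel \<Otimes>\<^sub>M lborel. P (fst p) \<and> P (snd p)"
proof -
  obtain N where N: "N \<in> null_sets lborel" "{x. \<not> P x} \<subseteq> N"
    using assms by (auto elim: AE_E3 simp: eventually_ae_filter)
  have "N \<times> UNIV \<in> null_sets (lborel \<Otimes>\<^sub>M lborel :: ('a \<times> 'a) measure)"
    using lborel.times_in_null_sets1[OF N(1), of UNIV] by simp
  moreover have "UNIV \<times> N \<in> null_sets (lborel \<Otimes>\<^sub>M lborel :: ('a \<times> 'a) measure)"
    by (rule lborel.times_in_null_sets2[OF _ N(1)]) simp
  ultimately have "N \<times> UNIV \<union> UNIV \<times> N \<in> null_sets (lborel \<Otimes>\<^sub>M lborel :: ('a \<times> 'a) measure)"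
    by (rule null_sets.Un)
  then show ?thesis
    by (rule AE_I') (use N(2) in force)
qed

locale dirichlet_setting =
  fixes j :: "real \<Rightarrow> real" and D :: "'a::euclidean_space set"
  assumes j_pos: "r > 0 \<Longrightarrow> j r > 0"
    and j_antimono: "0 < r \<Longrightarrow> r \<le> s \<Longrightarrow> j s \<le> j r"
    and open_D: "open D" and bounded_D: "bounded D"
    and null_frontier: "frontier D \<in> null_sets lborel"
begin

lemma D_sets [measurable]: "D \<in> sets borel"
  using open_D by simp

section \<open>Positivity, symmetry and measurability of the kernel\<close>

lemma jump_kernel_pos: "x \<noteq> y \<Longrightarrow> 0 < jump_kernel j x y"
  by (simp add: jump_kernel_def j_pos)

lemma jump_kernel_commute: "jump_kernel j x y = jump_kernel j y x"
  by (simp add: jump_kernel_def norm_minus_commute)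

text \<open>Nothing is known about \<open>j\<close> at or below 0. Monotonicity gives measurability
  on the positive half-line, and since a norm is nonnegative, only the diagonal remains, where the
  kernel is the constant \<open>j 0\<close>.\<close>

lemma measurable_jump_kernel [measurable]:
  assumes [measurable]: "f \<in> borel_measurable M" "g \<in> borel_measurable M"
  shows "(\<lambda>p. jump_kernel j (f p) (g p)) \<in> borel_measurable M"
proof -
  have "mono_on {0<..} (\<lambda>r. - j r)"
    using j_antimono by (auto simp: mono_on_def)
  then have "(\<lambda>r. - j r) \<in> borel_measurable (restrict_space borel {0<..})"
    by (rule borel_measurable_mono_on_fnc)
  then have "(\<lambda>r. indicator {0<..} r *\<^sub>R - j r) \<in> borel_measurable borel"
    by (subst (asm) borel_measurable_restrict_space_iff) auto
  then have [measurable]: "(\<lambda>r. - (indicator {0<..} r *\<^sub>R - j r)) \<in> borel_measurable borel"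
    by (rule borel_measurable_uminus)
  have "(\<lambda>p. if norm (f p - g p) = 0 then j 0
      else - (indicator {0<..} (norm (f p - g p)) *\<^sub>R - j (norm (f p - g p)))) \<in> borel_measurable M"
    by measurable
  then show ?thesis
    by (rule measurable_cong[THEN iffD1, rotated]) (auto simp: jump_kernel_def indicator_def)
qed

text \<open>Off the diagonal the kernel is positive and the maximum leaves it unchanged. On the
  diagonal \<open>j 0\<close> may be negative; the maximum makes the density nonnegative there, and
  the energy is unaffected because increments vanish on the diagonal.\<close>

definition energy_measure :: "('a \<times> 'a) measure" where
  "energy_measure = density (lborel \<Otimes>\<^sub>M lborel)
     (\<lambda>p. ennreal (indicator (UNIV - (- D) \<times> (- D)) p * max 0 (jump_kernel j (fst p) (snd p))))"

lemma sets_energy_measure [measurable_cong, simp]: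
  "sets energy_measure = sets (lborel \<Otimes>\<^sub>M lborel)"
  by (simp add: energy_measure_def)

lemma borel_measurable_energy_measure [simp]:
  "borel_measurable energy_measure = borel_measurable (lborel \<Otimes>\<^sub>M lborel)"
  by (rule measurable_cong_sets) simp_all

lemma energy_region_sets [measurable]: "UNIV - (- D) \<times> (- D) \<in> sets (lborel \<Otimes>\<^sub>M lborel)"
proof -
  have "(- D) \<times> (- D) \<in> sets (lborel \<Otimes>\<^sub>M lborel)"
    by (intro pair_measureI) auto
  from sets.compl_sets[OF this] show ?thesis
    by (simp add: space_pair_measure)
qed

lemma energy_density_eq:
  "energy_density j u v p = max 0 (jump_kernel j (fst p) (snd p)) * (increment u p * increment v p)"
  using jump_kernel_pos[of "fst p" "snd p"]
  by (cases "fst p = snd p") (auto simp: energy_density_def increment_def split: prod.splits)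

lemma set_integrable_energy_density_iff:
  assumes [measurable]: "u \<in> borel_measurable borel" "v \<in> borel_measurable borel"
  shows "set_integrable (lborel \<Otimes>\<^sub>M lborel) (UNIV - (- D) \<times> (- D)) (energy_density j u v) \<longleftrightarrow>
    integrable energy_measure (\<lambda>p. increment u p * increment v p)"
  unfolding energy_measure_def set_integrable_def
  by (subst integrable_density) (auto simp: energy_density_eq mult.assoc)

lemma energy_form_eq:
  assumes [measurable]: "u \<in> borel_measurable borel" "v \<in> borel_measurable borel"
  shows "energy_form j D u v = 1 / 2 * (LINT p|energy_measure. increment u p * increment v p)"
  unfolding energy_measure_def energy_form_def set_lebesgue_integral_def
  by (subst integral_density) (auto simp: energy_density_eq mult.assoc)

section \<open>The energy space and its subspace of functions vanishing outside
  \<open>D\<close>\<close>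

lemma energy_space_iff:
  "u \<in> energy_space j D \<longleftrightarrow> u \<in> borel_measurable borel \<and>
     set_integrable lborel D (\<lambda>x. (u x)\<^sup>2) \<and> integrable energy_measure (\<lambda>p. (increment u p)\<^sup>2)"
  using set_integrable_energy_density_iff[of u u] by (auto simp: energy_space_def power2_eq_square)

lemma energy_space_add:
  assumes "u \<in> energy_space j D" "v \<in> energy_space j D"
  shows "(\<lambda>x. u x + v x) \<in> energy_space j D"
proof -
  have [measurable]: "u \<in> borel_measurable borel" "v \<in> borel_measurable borel"
    using assms by (auto simp: energy_space_iff)
  have "integrable lborel (\<lambda>x. (indicator D x *\<^sub>R u x + indicator D x *\<^sub>R v x)\<^sup>2)"
    using assms
    by (intro integrable_square_add)
      (auto simp: energy_space_iff set_integrable_def power_mult_distrib indicator_power2)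
  then have "set_integrable lborel D (\<lambda>x. (u x + v x)\<^sup>2)"
    unfolding set_integrable_def
    by (rule Bochner_Integration.integrable_cong[OF refl, THEN iffD1, rotated]) (auto simp: indicator_def)
  moreover have "integrable energy_measure (\<lambda>p. (increment (\<lambda>x. u x + v x) p)\<^sup>2)"
    unfolding increment_add using assms
    by (intro integrable_square_add) (auto simp: energy_space_iff)
  ultimately show ?thesis
    by (auto simp: energy_space_iff)
qed

lemma energy_space_scale:
  assumes "u \<in> energy_space j D"
  shows "(\<lambda>x. c * u x) \<in> energy_space j D"
  using assms by (auto simp: energy_space_iff increment_scale power_mult_distrib)

lemma energy_space_zero_add:
  assumes "u \<in> energy_space_zero j D" "v \<in> energy_space_zero j D"
  shows "(\<lambda>x. u x + v x) \<in> energy_space_zero j D"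
  using assms by (auto simp: energy_space_zero_def energy_space_add)

lemma energy_space_zero_scale:
  assumes "u \<in> energy_space_zero j D"
  shows "(\<lambda>x. c * u x) \<in> energy_space_zero j D"
  using assms by (auto simp: energy_space_zero_def energy_space_scale)

lemma zero_in_energy_space_zero: "(\<lambda>x. 0) \<in> energy_space_zero j D"
  by (auto simp: energy_space_zero_def energy_space_iff increment_def set_integrable_def)

lemma integrable_increment_mult:
  assumes "u \<in> energy_space j D" "v \<in> energy_space j D"
  shows "integrable energy_measure (\<lambda>p. increment u p * increment v p)"
  using assms by (intro integrable_mult_of_squares) (auto simp: energy_space_iff)

text \<open>Since \<open>w\<close> vanishes outside \<open>D\<close>, a pair with one point in
  \<open>D\<close> and the other in an exterior ball contributes the full square of \<open>w\<close>
  to the energy. Extended integrals are used because the inequality must also apply to limits whose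
  square integrability is not yet known.\<close>

lemma nonlocal_poincare:
  obtains C where "C \<ge> 0" and "\<And>w. w \<in> borel_measurable borel \<Longrightarrow>
    AE x in lborel. x \<in> - D \<longrightarrow> w x = 0 \<Longrightarrow>
    (\<integral>\<^sup>+ x. ennreal (indicator D x * (w x)\<^sup>2) \<partial>lborel) \<le>
      ennreal C * (\<integral>\<^sup>+ p. ennreal ((increment w p)\<^sup>2) \<partial>energy_measure)"
proof -
  obtain R where R: "R > 0" "\<And>x. x \<in> D \<Longrightarrow> norm x \<le> R"
    using bounded_D by (auto simp: bounded_pos)
  obtain b :: 'a where b: "b \<in> Basis"
    using nonempty_Basis by blast
  \<comment> \<open>A ball outside \<open>D\<close>, where \<open>w\<close> vanishes, sees all of \<open>D\<close> with a kernel bounded below.\<close>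
  define A where "A = ball ((R + 1) *\<^sub>R b) 1"
  have [measurable]: "A \<in> sets borel"
    by (simp add: A_def)
  have normA: "R < norm y \<and> norm y < R + 2" if "y \<in> A" for y
  proof -
    have "norm ((R + 1) *\<^sub>R b) = R + 1"
      using R(1) b by simp
    moreover have "norm ((R + 1) *\<^sub>R b - y) < 1"
      using that by (simp add: A_def dist_norm)
    ultimately show ?thesis
      using norm_triangle_ineq2[of "(R + 1) *\<^sub>R b" y] norm_triangle_ineq3[of "(R + 1) *\<^sub>R b" y] by linarith
  qed
  have A_D: "y \<notin> D" if "y \<in> A" for y
    using normA[OF that] R(2)[of y] by auto
  \<comment> \<open>Points of \<open>D\<close> have norm at most \<open>R\<close> and points of
    \<open>A\<close> norm below \<open>R + 2\<close>, so their distance is at most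
    \<open>2 * R + 2\<close>; as \<open>j\<close> is non-increasing, its value there is a lower
    bound for the kernel.\<close>
  define \<kappa> where "\<kappa> = j (2 * R + 2)"
  have "\<kappa> > 0"
    using R(1) by (simp add: \<kappa>_def j_pos)
  have kernel: "\<kappa> \<le> jump_kernel j x y" if "x \<in> D" "y \<in> A" for x y
  proof -
    have "x \<noteq> y"
      using A_D that by auto
    moreover have "norm (x - y) \<le> 2 * R + 2"
      using norm_triangle_ineq4[of x y] normA[OF that(2)] R(2)[OF that(1)] by linarith
    ultimately show ?thesis
      unfolding \<kappa>_def jump_kernel_def by (intro j_antimono) auto
  qed
  define a where "a = measure lborel A"
  have "a > 0"
    by (simp add: a_def A_def content_ball_pos)
  have emA: "emeasure lborel A = ennreal a"
    unfolding a_def A_def using emeasure_lborel_ball_finite[of "(R + 1) *\<^sub>R b" 1]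
    by (intro emeasure_eq_ennreal_measure) (simp add: less_top)
  show ?thesis
  proof (rule that[of "1 / (\<kappa> * a)"])
    show "0 \<le> 1 / (\<kappa> * a)"
      using \<open>\<kappa> > 0\<close> \<open>a > 0\<close> by simp
    fix w :: "'a \<Rightarrow> real"
    assume [measurable]: "w \<in> borel_measurable borel"
      and w0: "AE x in lborel. x \<in> - D \<longrightarrow> w x = 0"
    let ?I = "\<integral>\<^sup>+ x. ennreal (indicator D x * (w x)\<^sup>2) \<partial>lborel"
    have "ennreal (\<kappa> * a) * ?I = (\<integral>\<^sup>+ x. \<integral>\<^sup>+ y. ennreal (\<kappa> * (indicator D x * (w x)\<^sup>2)) * indicator A y \<partial>lborel \<partial>lborel)"
      using \<open>\<kappa> > 0\<close> \<open>a > 0\<close>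
      by (simp add: nn_integral_cmult nn_integral_multc ennreal_mult emA mult_ac)
    also have "\<dots> = (\<integral>\<^sup>+ p. ennreal (\<kappa> * (indicator D (fst p) * (w (fst p))\<^sup>2)) * indicator A (snd p) \<partial>(lborel \<Otimes>\<^sub>M lborel))"
      by (subst lborel.nn_integral_fst[symmetric]) auto
    also have "\<dots> \<le> (\<integral>\<^sup>+ p. ennreal (indicator (UNIV - (- D) \<times> (- D)) p * max 0 (jump_kernel j (fst p) (snd p)))
        * ennreal ((increment w p)\<^sup>2) \<partial>(lborel \<Otimes>\<^sub>M lborel))"
    proof (intro nn_integral_mono_AE, use AE_lborel_pair_fst_snd[OF w0] in eventually_elim)
      case (elim p)
      show ?case
      proof (cases "fst p \<in> D \<and> snd p \<in> A")
        case True
        then have "w (snd p) = 0"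
          using elim A_D by auto
        moreover have "\<kappa> * (w (fst p))\<^sup>2 \<le> max 0 (jump_kernel j (fst p) (snd p)) * (w (fst p))\<^sup>2"
          using kernel[of "fst p" "snd p"] True by (intro mult_right_mono) auto
        ultimately show ?thesis
          using True by (cases p) (auto simp: increment_def ennreal_mult[symmetric] intro!: ennreal_leI)
      qed (auto simp: indicator_def)
    qed
    also have "\<dots> = (\<integral>\<^sup>+ p. ennreal ((increment w p)\<^sup>2) \<partial>energy_measure)"
      unfolding energy_measure_def by (subst nn_integral_density) auto
    finally have le: "ennreal (\<kappa> * a) * ?I \<le> (\<integral>\<^sup>+ p. ennreal ((increment w p)\<^sup>2) \<partial>energy_measure)" .
    have "?I = ennreal (1 / (\<kappa> * a)) * (ennreal (\<kappa> * a) * ?I)"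
      using \<open>\<kappa> > 0\<close> \<open>a > 0\<close> by (simp add: mult.assoc[symmetric] ennreal_mult[symmetric])
    also have "\<dots> \<le> ennreal (1 / (\<kappa> * a)) * (\<integral>\<^sup>+ p. ennreal ((increment w p)\<^sup>2) \<partial>energy_measure)"
      by (intro mult_left_mono le) simp
    finally show "?I \<le> \<dots>" .
  qed
qed

subsection \<open>Pairs with one point outside the domain\<close>

text \<open>Its two points lie in disjoint sets, so its support avoids the diagonal and the kernel
  needs no truncation. Integrating out the second point yields the weight of
  \<open>exterior_measure\<close>.\<close>

definition cross_weight :: "'a \<times> 'a \<Rightarrow> real" where
  "cross_weight p = indicator (- D) (fst p) * indicator D (snd p) * jump_kernel j (fst p) (snd p)"

lemma cross_weight_nonneg: "0 \<le> cross_weight p"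
  using jump_kernel_pos[of "fst p" "snd p"]
  by (cases "fst p = snd p") (auto simp: cross_weight_def indicator_def)

lemma measurable_cross_weight [measurable]:
  "cross_weight \<in> borel_measurable (lborel \<Otimes>\<^sub>M lborel)"
  unfolding cross_weight_def[abs_def] by measurable

text \<open>The pairs meeting \<open>D\<close> form three blocks. The block with both points in
  \<open>D\<close> is killed by \<open>zero\<close>, and the two mixed blocks are mirror images of
  each other.\<close>

lemma energy_weight_split:
  fixes h :: "'a \<times> 'a \<Rightarrow> real"
  assumes sym: "\<And>x y. h (y, x) = h (x, y)" and zero: "\<And>x y. x \<in> D \<Longrightarrow> y \<in> D \<Longrightarrow> h (x, y) = 0"
  shows "indicator (UNIV - (- D) \<times> (- D)) p * max 0 (jump_kernel j (fst p) (snd p)) * h p =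
    cross_weight p * h p + (case p of (x, y) \<Rightarrow> cross_weight (y, x) * h (y, x))"
proof (cases p)
  case (Pair x y)
  have "x \<noteq> y \<Longrightarrow> max 0 (jump_kernel j x y) = jump_kernel j x y"
    using jump_kernel_pos[of x y] by simp
  then show ?thesis
    using Pair zero[of x y]
    by (cases "x \<in> D"; cases "y \<in> D"; cases "x = y")
      (auto simp: cross_weight_def sym jump_kernel_commute[of y x])
qed

text \<open>Both mixed blocks contribute equally by symmetry. The resulting factor 2 later cancels
  the factor 1/2 in the energy form.\<close>

lemma
  fixes h :: "'a \<times> 'a \<Rightarrow> real"
  assumes [measurable]: "h \<in> borel_measurable (lborel \<Otimes>\<^sub>M lborel)"
    and sym: "\<And>x y. h (y, x) = h (x, y)" and zero: "\<And>x y. x \<in> D \<Longrightarrow> y \<in> D \<Longrightarrow> h (x, y) = 0"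
    and int: "integrable (lborel \<Otimes>\<^sub>M lborel) (\<lambda>p. cross_weight p * h p)"
  shows integrable_energy_measure_cross: "integrable energy_measure h"
    and integral_energy_measure_cross:
      "(LINT p|energy_measure. h p) = 2 * (LINT p|(lborel \<Otimes>\<^sub>M lborel). cross_weight p * h p)"
proof -
  let ?G = "\<lambda>p. cross_weight p * h p"
  have swap: "integrable (lborel \<Otimes>\<^sub>M lborel) (\<lambda>(x, y). ?G (y, x))"
    using lborel_pair.integrable_product_swap[OF int] by simp
  have "integrable energy_measure h \<longleftrightarrow>
      integrable (lborel \<Otimes>\<^sub>M lborel) (\<lambda>p. ?G p + (case p of (x, y) \<Rightarrow> ?G (y, x)))"
    unfolding energy_measure_def
    by (subst integrable_density) (auto simp: energy_weight_split[where h = h, OF sym zero])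
  then show "integrable energy_measure h"
    using int swap by simp
  have "(LINT p|energy_measure. h p) =
      (LINT p|(lborel \<Otimes>\<^sub>M lborel). ?G p + (case p of (x, y) \<Rightarrow> ?G (y, x)))"
    unfolding energy_measure_def
    by (subst integral_density) (auto simp: energy_weight_split[where h = h, OF sym zero])
  also have "\<dots> = 2 * (LINT p|(lborel \<Otimes>\<^sub>M lborel). ?G p)"
    using int swap lborel_pair.integral_product_swap[of ?G] by simp
  finally show "(LINT p|energy_measure. h p) = 2 * (LINT p|(lborel \<Otimes>\<^sub>M lborel). ?G p)" .
qed

text \<open>The cross weight is dominated by the density of \<open>energy_measure\<close>, so no
  symmetry of \<open>h\<close> is involved in this direction.\<close>

lemma integrable_cross_weight:
  fixes h :: "'a \<times> 'a \<Rightarrow> real"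
  assumes int: "integrable energy_measure h"
  shows "integrable (lborel \<Otimes>\<^sub>M lborel) (\<lambda>p. cross_weight p * h p)"
proof (rule Bochner_Integration.integrable_bound)
  have [measurable]: "h \<in> borel_measurable (lborel \<Otimes>\<^sub>M lborel)"
    using borel_measurable_integrable[OF int] by simp
  show "integrable (lborel \<Otimes>\<^sub>M lborel)
      (\<lambda>p. indicator (UNIV - (- D) \<times> (- D)) p * max 0 (jump_kernel j (fst p) (snd p)) * h p)"
    using int unfolding energy_measure_def
    by (subst (asm) integrable_density) auto
  have "\<bar>cross_weight p\<bar> \<le>
      \<bar>indicator (UNIV - (- D) \<times> (- D)) p * max 0 (jump_kernel j (fst p) (snd p))\<bar>" for p :: "'a \<times> 'a"
    using cross_weight_nonneg[of p] by (cases p) (auto simp: cross_weight_def indicator_def)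
  then show "AE p in lborel \<Otimes>\<^sub>M lborel. norm (cross_weight p * h p) \<le>
      norm (indicator (UNIV - (- D) \<times> (- D)) p * max 0 (jump_kernel j (fst p) (snd p)) * h p)"
    unfolding real_norm_def abs_mult[of _ "h _"] by (intro AE_I2 mult_right_mono) auto
  show "(\<lambda>p. cross_weight p * h p) \<in> borel_measurable (lborel \<Otimes>\<^sub>M lborel)"
    by measurable
qed

lemma measurable_exterior_weight [measurable]: "exterior_weight j D \<in> borel_measurable borel"
proof -
  have "(\<lambda>x. \<integral>\<^sup>+ y. ennreal (jump_kernel j (fst (x, y)) (snd (x, y))) * indicator D (snd (x, y)) \<partial>lborel)
      \<in> borel_measurable lborel"
    by (intro lborel.borel_measurable_nn_integral_fst) measurable
  then show ?thesis
    by (simp add: exterior_weight_def[abs_def])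
qed

text \<open>Tonelli: the exterior measure is the first marginal of the cross weight.\<close>

lemma nn_integral_cross_weight:
  assumes [measurable]: "f \<in> borel_measurable borel"
  shows "(\<integral>\<^sup>+ p. ennreal (cross_weight p) * f (fst p) \<partial>(lborel \<Otimes>\<^sub>M lborel)) =
    (\<integral>\<^sup>+ x. f x \<partial>exterior_measure j D)"
proof -
  have "(\<integral>\<^sup>+ p. ennreal (cross_weight p) * f (fst p) \<partial>(lborel \<Otimes>\<^sub>M lborel)) =
      (\<integral>\<^sup>+ x. \<integral>\<^sup>+ y. ennreal (cross_weight (x, y)) * f x \<partial>lborel \<partial>lborel)"
    by (subst lborel.nn_integral_fst[symmetric]) auto
  also have "\<dots> = (\<integral>\<^sup>+ x. (exterior_weight j D x * indicator (- D) x) * f x \<partial>lborel)"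
  proof (rule nn_integral_cong)
    fix x
    have "(\<integral>\<^sup>+ y. ennreal (cross_weight (x, y)) * f x \<partial>lborel) =
        (\<integral>\<^sup>+ y. (ennreal (jump_kernel j x y) * indicator D y) * (indicator (- D) x * f x) \<partial>lborel)"
      by (intro nn_integral_cong) (auto simp: cross_weight_def indicator_def)
    also have "\<dots> = exterior_weight j D x * (indicator (- D) x * f x)"
      unfolding exterior_weight_def by (subst nn_integral_multc) auto
    finally show "(\<integral>\<^sup>+ y. ennreal (cross_weight (x, y)) * f x \<partial>lborel) =
        (exterior_weight j D x * indicator (- D) x) * f x"
      by (simp add: mult.assoc)
  qed
  also have "\<dots> = (\<integral>\<^sup>+ x. f x \<partial>exterior_measure j D)"
    unfolding exterior_measure_def by (subst nn_integral_density) auto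
  finally show ?thesis .
qed

lemma exterior_L2_subset_energy_space:
  assumes "\<eta> \<in> exterior_L2 j D"
  shows "\<eta> \<in> energy_space j D"
proof -
  have [measurable]: "\<eta> \<in> borel_measurable borel" and zero: "\<And>x. x \<in> D \<Longrightarrow> \<eta> x = 0"
    and int: "integrable (exterior_measure j D) (\<lambda>x. (\<eta> x)\<^sup>2)"
    using assms by (auto simp: exterior_L2_def)
  \<comment> \<open>On the support of the cross weight the second point lies in \<open>D\<close>,
    where \<eta> vanishes.\<close>
  have cross: "cross_weight p * (increment \<eta> p)\<^sup>2 = cross_weight p * (\<eta> (fst p))\<^sup>2" for p
    by (auto simp: cross_weight_def increment_def indicator_def zero)
  have "(\<integral>\<^sup>+ p. ennreal (norm (cross_weight p * (\<eta> (fst p))\<^sup>2)) \<partial>(lborel \<Otimes>\<^sub>M lborel)) =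
      (\<integral>\<^sup>+ p. ennreal (cross_weight p) * ennreal ((\<eta> (fst p))\<^sup>2) \<partial>(lborel \<Otimes>\<^sub>M lborel))"
    by (simp add: cross_weight_nonneg ennreal_mult abs_mult)
  also have "\<dots> = (\<integral>\<^sup>+ x. ennreal ((\<eta> x)\<^sup>2) \<partial>exterior_measure j D)"
    by (rule nn_integral_cross_weight) simp
  also have "\<dots> < \<infinity>"
    using int by (simp add: integrable_iff_bounded)
  finally have "integrable (lborel \<Otimes>\<^sub>M lborel) (\<lambda>p. cross_weight p * (increment \<eta> p)\<^sup>2)"
    unfolding cross by (intro integrableI_bounded) auto
  then have "integrable energy_measure (\<lambda>p. (increment \<eta> p)\<^sup>2)"
    by (intro integrable_energy_measure_cross) (auto simp: increment_def power2_commute zero)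
  moreover have "set_integrable lborel D (\<lambda>x. (\<eta> x)\<^sup>2)"
  proof -
    have "(\<lambda>x. indicator D x *\<^sub>R (\<eta> x)\<^sup>2) = (\<lambda>x. 0)"
      by (auto simp: indicator_def zero)
    then show ?thesis
      by (simp add: set_integrable_def)
  qed
  ultimately show ?thesis
    by (simp add: energy_space_iff)
qed

subsection \<open>Existence of solutions\<close>

lemma nn_integral_increment_sq:
  assumes "integrable energy_measure (\<lambda>p. (increment w p)\<^sup>2)"
  shows "(\<integral>\<^sup>+ p. ennreal ((increment w p)\<^sup>2) \<partial>energy_measure) =
    ennreal (LINT p|energy_measure. (increment w p)\<^sup>2)"
  using assms by (intro nn_integral_eq_integral) auto

text \<open>This is the closedness condition of \<open>L2_orthogonal_projection\<close> for
  increments. Convergence of increments alone does not determine a limit function; the Poincare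
  inequality turns it into a.e. convergence of the functions on \<open>D\<close>, and outside
  \<open>D\<close> they all vanish a.e. Fatou's lemma then gives the limit finite energy.\<close>

lemma energy_space_zero_limit:
  fixes w :: "nat \<Rightarrow> 'a \<Rightarrow> real"
  assumes w: "\<And>n. w n \<in> energy_space_zero j D"
    and fast: "\<And>n. (LINT p|energy_measure. (increment (w (Suc n)) p - increment (w n) p)\<^sup>2) \<le> (1/4)^n"
    and bounded: "\<And>n. (LINT p|energy_measure. (increment (w n) p)\<^sup>2) \<le> B"
  shows "\<exists>v\<in>energy_space_zero j D.
    AE p in energy_measure. (\<lambda>n. increment (w n) p) \<longlonglongrightarrow> increment v p"
proof -
  have wE: "w n \<in> energy_space j D" and w0: "AE x in lborel. x \<in> - D \<longrightarrow> w n x = 0" for n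
    using w[of n] by (auto simp: energy_space_zero_def)
  have wm [measurable]: "w n \<in> borel_measurable borel" for n
    using wE[of n] by (simp add: energy_space_iff)
  obtain C where "C \<ge> 0" and C: "\<And>w. w \<in> borel_measurable borel \<Longrightarrow>
      AE x in lborel. x \<in> - D \<longrightarrow> w x = 0 \<Longrightarrow>
      (\<integral>\<^sup>+ x. ennreal (indicator D x * (w x)\<^sup>2) \<partial>lborel) \<le>
        ennreal C * (\<integral>\<^sup>+ p. ennreal ((increment w p)\<^sup>2) \<partial>energy_measure)"
    using nonlocal_poincare by blast
  have "(\<integral>\<^sup>+ x. ennreal ((indicator D x * w (Suc n) x - indicator D x * w n x)\<^sup>2) \<partial>lborel)
      \<le> ennreal (C * (1/4)^n)" for n
  proof -
    let ?d = "\<lambda>x. w (Suc n) x - w n x"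
    have d: "?d \<in> energy_space_zero j D"
      using energy_space_zero_add[OF w energy_space_zero_scale[OF w, of "-1"]] by simp
    have "(\<integral>\<^sup>+ x. ennreal ((indicator D x * w (Suc n) x - indicator D x * w n x)\<^sup>2) \<partial>lborel)
        = (\<integral>\<^sup>+ x. ennreal (indicator D x * (?d x)\<^sup>2) \<partial>lborel)"
      by (intro nn_integral_cong) (auto simp: indicator_def)
    also have "\<dots> \<le> ennreal C * (\<integral>\<^sup>+ p. ennreal ((increment ?d p)\<^sup>2) \<partial>energy_measure)"
      using d by (intro C) (auto simp: energy_space_zero_def energy_space_iff)
    also have "(\<integral>\<^sup>+ p. ennreal ((increment ?d p)\<^sup>2) \<partial>energy_measure)
        = ennreal (LINT p|energy_measure. (increment ?d p)\<^sup>2)"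
      using d by (intro nn_integral_increment_sq) (auto simp: energy_space_zero_def energy_space_iff)
    also have "(LINT p|energy_measure. (increment ?d p)\<^sup>2) \<le> (1/4)^n"
      using fast[of n] by (simp add: increment_diff)
    finally show ?thesis
      using \<open>C \<ge> 0\<close> by (simp add: ennreal_mult mult_left_mono ennreal_leI)
  qed
  then have conv: "AE x in lborel. convergent (\<lambda>n. indicator D x * w n x)"
    using \<open>C \<ge> 0\<close> by (intro AE_convergent_of_fast_L2_Cauchy) auto
  \<comment> \<open>Where the sequence diverges \<open>lim\<close> is unspecified, but by
    \<open>conv\<close> this concerns only a null subset of \<open>D\<close>.\<close>
  define v where "v x = (if x \<in> D then lim (\<lambda>n. w n x) else 0)" for x
  have [measurable]: "v \<in> borel_measurable borel"
    unfolding v_def[abs_def] by measurable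
  have v0: "AE x in lborel. x \<in> - D \<longrightarrow> v x = 0"
    by (simp add: v_def)
  have "AE x in lborel. \<forall>n. x \<in> - D \<longrightarrow> w n x = 0"
    unfolding AE_all_countable using w0 by blast
  with conv have lim: "AE x in lborel. (\<lambda>n. w n x) \<longlonglongrightarrow> v x"
  proof eventually_elim
    case (elim x)
    then show ?case
      by (cases "x \<in> D") (auto simp: v_def convergent_LIMSEQ_iff)
  qed
  have "AE p in lborel \<Otimes>\<^sub>M lborel. (\<lambda>n. increment (w n) p) \<longlonglongrightarrow> increment v p"
    using AE_lborel_pair_fst_snd[OF lim]
    by eventually_elim (auto simp: increment_def intro!: tendsto_diff)
  then have limE: "AE p in energy_measure. (\<lambda>n. increment (w n) p) \<longlonglongrightarrow> increment v p"
    unfolding energy_measure_def by (subst AE_density) auto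
  have "(\<integral>\<^sup>+ p. ennreal ((increment v p)\<^sup>2) \<partial>energy_measure)
      = (\<integral>\<^sup>+ p. liminf (\<lambda>n. ennreal ((increment (w n) p)\<^sup>2)) \<partial>energy_measure)"
  proof (intro nn_integral_cong_AE, use limE in eventually_elim)
    case (elim p)
    then have "(\<lambda>n. ennreal ((increment (w n) p)\<^sup>2)) \<longlonglongrightarrow> ennreal ((increment v p)\<^sup>2)"
      by (intro tendsto_intros)
    then show ?case
      by (rule lim_imp_Liminf[OF trivial_limit_sequentially, symmetric])
  qed
  also have "\<dots> \<le> liminf (\<lambda>n. \<integral>\<^sup>+ p. ennreal ((increment (w n) p)\<^sup>2) \<partial>energy_measure)"
    by (intro nn_integral_liminf) measurable
  also have "\<dots> \<le> liminf (\<lambda>n. ennreal B)"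
    using wE bounded
    by (intro Liminf_mono always_eventually allI)
      (auto simp: nn_integral_increment_sq energy_space_iff ennreal_leI)
  finally have fin: "(\<integral>\<^sup>+ p. ennreal ((increment v p)\<^sup>2) \<partial>energy_measure) < \<infinity>"
    by (simp add: Liminf_const le_less_trans)
  then have "integrable energy_measure (\<lambda>p. (increment v p)\<^sup>2)"
    by (intro integrableI_bounded) auto
  moreover have "set_integrable lborel D (\<lambda>x. (v x)\<^sup>2)"
    unfolding set_integrable_def
  proof (rule integrableI_bounded)
    have "(\<integral>\<^sup>+ x. ennreal (norm (indicator D x *\<^sub>R (v x)\<^sup>2)) \<partial>lborel)
        = (\<integral>\<^sup>+ x. ennreal (indicator D x * (v x)\<^sup>2) \<partial>lborel)"
      by simp
    also have "\<dots> \<le> ennreal C * (\<integral>\<^sup>+ p. ennreal ((increment v p)\<^sup>2) \<partial>energy_measure)"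
      by (intro C v0) simp
    also have "\<dots> < \<infinity>"
      using fin by (simp add: ennreal_mult_less_top)
    finally show "(\<integral>\<^sup>+ x. ennreal (norm (indicator D x *\<^sub>R (v x)\<^sup>2)) \<partial>lborel) < \<infinity>" .
  qed simp
  ultimately have "v \<in> energy_space_zero j D"
    using v0 by (auto simp: energy_space_zero_def energy_space_iff)
  with limE show ?thesis
    by blast
qed

text \<open>The clause of \<open>dirichlet_to_neumann\<close> that links \<open>N\<close> to the
  energy speaks only of data having solutions, so a test datum is usable only once its solution is
  produced. Orthogonality of the projected increment to all increments from
  \<open>energy_space_zero\<close> is the weak equation.\<close>

lemma dirichlet_solution_exists:
  assumes \<eta>: "\<eta> \<in> exterior_L2 j D"
  shows "\<exists>v. dirichlet_solution j D \<eta> v"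
proof -
  let ?S = "increment ` energy_space_zero j D"
  have \<eta>E: "\<eta> \<in> energy_space j D"
    using \<eta> by (rule exterior_L2_subset_energy_space)
  have sub: "w \<in> energy_space_zero j D \<Longrightarrow> w \<in> energy_space j D" for w
    by (simp add: energy_space_zero_def)
  have "\<exists>f\<in>?S. \<forall>h\<in>?S. (LINT p|energy_measure. (increment \<eta> p + f p) * h p) = 0"
  proof (rule L2_orthogonal_projection)
    show "f \<in> borel_measurable energy_measure" if "f \<in> ?S" for f
      using that sub measurable_increment by (auto simp: energy_space_iff)
    show "integrable energy_measure (\<lambda>p. (f p)\<^sup>2)" if "f \<in> ?S" for f
      using that sub by (auto simp: energy_space_iff)
    show "(\<lambda>p. 0) \<in> ?S"
      using zero_in_energy_space_zero by (intro image_eqI[of _ _ "\<lambda>x. 0"]) (auto simp: increment_def)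
    show "(\<lambda>p. f p + h p) \<in> ?S" if "f \<in> ?S" "h \<in> ?S" for f h
      using that energy_space_zero_add by (force simp: increment_add[symmetric])
    show "(\<lambda>p. c * f p) \<in> ?S" if "f \<in> ?S" for f c
      using that energy_space_zero_scale by (force simp: increment_scale[symmetric])
    show "increment \<eta> \<in> borel_measurable energy_measure" 
      "integrable energy_measure (\<lambda>p. (increment \<eta> p)\<^sup>2)"
      using \<eta>E measurable_increment by (auto simp: energy_space_iff)
    show "\<exists>f\<in>?S. AE p in energy_measure. (\<lambda>n. F n p) \<longlonglongrightarrow> f p"
      if "\<And>n. F n \<in> ?S"
        and "\<And>n. (LINT p|energy_measure. (F (Suc n) p - F n p)\<^sup>2) \<le> (1/4)^n"
        and "\<And>n. (LINT p|energy_measure. (F n p)\<^sup>2) \<le> B" for F B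
    proof -
      have "\<forall>n. \<exists>w\<in>energy_space_zero j D. F n = increment w"
        using that(1) by auto
      then obtain w where "\<And>n. w n \<in> energy_space_zero j D" "\<And>n. F n = increment (w n)"
        by metis
      with that(2,3) energy_space_zero_limit[of w B] show ?thesis
        by auto
    qed
  qed
  then obtain w where w: "w \<in> energy_space_zero j D" and
    orth: "\<And>h. h \<in> energy_space_zero j D \<Longrightarrow>
      (LINT p|energy_measure. (increment \<eta> p + increment w p) * increment h p) = 0"
    by auto
  let ?v = "\<lambda>x. \<eta> x + w x"
  have v: "?v \<in> energy_space j D"
    by (intro energy_space_add \<eta>E sub w)
  moreover have "(\<lambda>x. ?v x - \<eta> x) \<in> energy_space_zero j D"
    using w by simp
  moreover have "energy_form j D ?v h = 0" if "h \<in> energy_space_zero j D" for h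
    using v sub[OF that] orth[OF that]
    by (subst energy_form_eq) (auto simp: energy_space_iff increment_add)
  ultimately show ?thesis
    unfolding dirichlet_solution_def by blast
qed

subsection \<open>The normal derivative\<close>

text \<open>A real-valued version of \<open>exterior_weight\<close>. The cut-off at the closure
  restricts it to points where the weight is finite; on the frontier the weight may be
  infinite.\<close>

definition exterior_density :: "'a \<Rightarrow> real" where
  "exterior_density x = indicator (- closure D) x * (LINT y:D|lborel. jump_kernel j x y)"

lemma D_disjoint_exterior: "x \<in> - closure D \<Longrightarrow> x \<notin> D"
  using closure_subset by blast

text \<open>A point outside the closure has a positive distance \<open>e\<close> to
  \<open>D\<close>, so the kernel is at most \<open>j e\<close> on \<open>D\<close>, a set of finite
  measure.\<close>

lemma set_integrable_jump_kernel:
  assumes x: "x \<in> - closure D"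
  shows "set_integrable lborel D (jump_kernel j x)"
proof -
  obtain e where e: "e > 0" "ball x e \<subseteq> - closure D"
    using x open_contains_ball[of "- closure D"] by auto
  have "emeasure lborel D < \<infinity>"
    using bounded_D by (rule emeasure_bounded_finite)
  then have "integrable lborel (\<lambda>y. j e * indicator D y)"
    by simp
  then show ?thesis
    unfolding set_integrable_def
  proof (rule Bochner_Integration.integrable_bound)
    have "\<bar>jump_kernel j x y\<bar> \<le> \<bar>j e\<bar>" if "y \<in> D" for y
    proof -
      have "e \<le> norm (x - y)"
        using e(2) that closure_subset[of D] by (auto simp: subset_iff dist_norm not_less[symmetric])
      moreover have "0 < norm (x - y)"
        using e(1) calculation by linarith
      ultimately show ?thesis
        using j_antimono[OF e(1)] j_pos e(1) by (simp add: jump_kernel_def less_imp_le abs_of_pos)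
    qed
    then show "AE y in lborel. norm (indicator D y *\<^sub>R jump_kernel j x y) \<le> norm (j e * indicator D y)"
      by (auto simp: indicator_def)
  qed measurable
qed

lemma jump_kernel_exterior_nonneg:
  assumes "x \<in> - closure D"
  shows "0 \<le> indicator D y *\<^sub>R jump_kernel j x y"
  using D_disjoint_exterior[OF assms] jump_kernel_pos[of x y]
  by (cases "x = y") (auto simp: indicator_def)

lemma jump_kernel_integral_nonneg:
  assumes x: "x \<in> - closure D"
  shows "0 \<le> (LINT y:D|lborel. jump_kernel j x y)"
  unfolding set_lebesgue_integral_def using jump_kernel_exterior_nonneg[OF x]
  by (intro integral_nonneg_AE) auto

lemma exterior_density_nonneg: "0 \<le> exterior_density x"
  using jump_kernel_integral_nonneg[of x] by (auto simp: exterior_density_def indicator_def)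

lemma measurable_set_integral_pair:
  fixes f :: "'a \<times> 'a \<Rightarrow> real"
  assumes [measurable]: "f \<in> borel_measurable (lborel \<Otimes>\<^sub>M lborel)"
  shows "(\<lambda>x. LINT y:D|lborel. f (x, y)) \<in> borel_measurable borel"
proof -
  have "(\<lambda>x. LINT y|lborel. indicator D (snd (x, y)) *\<^sub>R f (x, y)) \<in> borel_measurable lborel"
    by (intro lborel.borel_measurable_lebesgue_integral) measurable
  then show ?thesis
    by (simp add: set_lebesgue_integral_def)
qed

lemma measurable_jump_kernel_integral [measurable]:
  "(\<lambda>x. LINT y:D|lborel. jump_kernel j x y) \<in> borel_measurable borel"
  using measurable_set_integral_pair[of "\<lambda>p. jump_kernel j (fst p) (snd p)"] by simp

lemma measurable_exterior_density [measurable]: "exterior_density \<in> borel_measurable borel"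
  unfolding exterior_density_def[abs_def] by measurable

lemma measurable_normal_derivative [measurable]:
  assumes [measurable]: "u \<in> borel_measurable borel"
  shows "normal_derivative j D u \<in> borel_measurable borel"
proof -
  have [measurable]: "(\<lambda>x. LINT y:D|lborel. (u x - u y) * jump_kernel j x y) \<in> borel_measurable borel"
    using measurable_set_integral_pair[of "\<lambda>p. (u (fst p) - u (snd p)) * jump_kernel j (fst p) (snd p)"]
    by simp
  show ?thesis
    unfolding normal_derivative_def[abs_def] by measurable
qed

section \<open>The exterior measure through a real-valued density\<close>

lemma AE_not_frontier: "AE x in lborel. x \<notin> frontier D"
  using null_frontier by (rule AE_not_in)

text \<open>Off the null frontier a point lies either in \<open>D\<close>, where both densities
  vanish, or outside the closure, where the weight is finite and equals the Bochner
  integral.\<close>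

lemma exterior_measure_eq:
  "exterior_measure j D = density lborel (\<lambda>x. ennreal (exterior_density x))"
  unfolding exterior_measure_def
proof (rule density_cong)
  show "AE x in lborel. exterior_weight j D x * indicator (- D) x = ennreal (exterior_density x)"
    using AE_not_frontier
  proof eventually_elim
    case (elim x)
    show ?case
    proof (cases "x \<in> - closure D")
      case True
      have "exterior_weight j D x = (\<integral>\<^sup>+ y. ennreal (indicator D y *\<^sub>R jump_kernel j x y) \<partial>lborel)"
        unfolding exterior_weight_def by (intro nn_integral_cong) (auto simp: indicator_def)
      also have "\<dots> = ennreal (LINT y:D|lborel. jump_kernel j x y)"
        unfolding set_lebesgue_integral_def
      proof (rule nn_integral_eq_integral)
        show "integrable lborel (\<lambda>y. indicator D y *\<^sub>R jump_kernel j x y)"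
          using set_integrable_jump_kernel[OF True] by (simp add: set_integrable_def)
        show "AE y in lborel. 0 \<le> indicator D y *\<^sub>R jump_kernel j x y"
          using jump_kernel_exterior_nonneg[OF True] by simp
      qed
      finally show ?thesis
        using True D_disjoint_exterior[OF True] by (simp add: exterior_density_def)
    next
      case False
      then have "x \<in> D"
        using elim open_D by (auto simp: frontier_def interior_open)
      then show ?thesis
        using False by (simp add: exterior_density_def)
    qed
  qed
qed measurable

lemma AE_exterior_measureI:
  assumes "AE x in lborel. x \<in> - closure D \<longrightarrow> P x"
  shows "AE x in exterior_measure j D. P x"
proof -
  have "AE x in lborel. 0 < ennreal (exterior_density x) \<longrightarrow> P x"
    using assms by eventually_elim (auto simp: exterior_density_def indicator_def split: if_splits)
  then show ?thesis
    unfolding exterior_measure_eq by (subst AE_density) simp_all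
qed

lemma integrable_exterior_measure_iff:
  fixes f :: "'a \<Rightarrow> real"
  assumes "f \<in> borel_measurable borel"
  shows "integrable (exterior_measure j D) f \<longleftrightarrow> integrable lborel (\<lambda>x. exterior_density x * f x)"
  unfolding exterior_measure_eq using assms
  by (subst integrable_density) (auto simp: exterior_density_nonneg)

lemma integral_exterior_measure:
  fixes f :: "'a \<Rightarrow> real"
  assumes "f \<in> borel_measurable borel"
  shows "(LINT x|exterior_measure j D. f x) = (LINT x|lborel. exterior_density x * f x)"
  unfolding exterior_measure_eq using assms
  by (subst integral_density) (auto simp: exterior_density_nonneg)

text \<open>The delicate case is a vanishing denominator, where division returns 0: then the
  nonnegative kernel vanishes a.e. on \<open>D\<close>, and so does the numerator integral.\<close>

lemma normal_derivative_mult_weight: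
  assumes x: "x \<in> - closure D"
  shows "normal_derivative j D u x * (LINT y:D|lborel. jump_kernel j x y) =
    (LINT y:D|lborel. (u x - u y) * jump_kernel j x y)"
proof (cases "(LINT y:D|lborel. jump_kernel j x y) = 0")
  case True
  have "AE y in lborel. indicator D y *\<^sub>R jump_kernel j x y = 0"
  proof (rule integral_nonneg_eq_0_iff_AE[THEN iffD1])
    show "integrable lborel (\<lambda>y. indicator D y *\<^sub>R jump_kernel j x y)"
      using set_integrable_jump_kernel[OF x] by (simp add: set_integrable_def)
    show "AE y in lborel. 0 \<le> indicator D y *\<^sub>R jump_kernel j x y"
      using jump_kernel_exterior_nonneg[OF x] by simp
    show "(LINT y|lborel. indicator D y *\<^sub>R jump_kernel j x y) = 0"
      using True by (simp add: set_lebesgue_integral_def)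
  qed
  then have "(LINT y:D|lborel. (u x - u y) * jump_kernel j x y) = 0"
    unfolding set_lebesgue_integral_def
    by (intro integral_eq_zero_AE) (auto elim!: eventually_mono)
  with True show ?thesis
    by simp
next
  case False
  then show ?thesis
    using x by (simp add: normal_derivative_def)
qed

text \<open>The kernel has finite mass on \<open>D\<close>, so square integrability against it
  implies integrability, through \<open>\<bar>a\<bar> \<le> 1 + a\<^sup>2\<close>.\<close>

lemma set_integrable_increment_kernel:
  assumes [measurable]: "u \<in> borel_measurable borel" and x: "x \<in> - closure D"
    and sq: "set_integrable lborel D (\<lambda>y. (u x - u y)\<^sup>2 * jump_kernel j x y)"
  shows "set_integrable lborel D (\<lambda>y. (u x - u y) * jump_kernel j x y)"
  unfolding set_integrable_def
proof (rule Bochner_Integration.integrable_bound)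
  show "integrable lborel (\<lambda>y. indicator D y *\<^sub>R jump_kernel j x y +
      indicator D y *\<^sub>R ((u x - u y)\<^sup>2 * jump_kernel j x y))"
    using sq set_integrable_jump_kernel[OF x] by (simp add: set_integrable_def)
  have *: "\<bar>a\<bar> \<le> 1 + a\<^sup>2" for a :: real
    using zero_le_power2[of "\<bar>a\<bar> - 1"] by (simp add: power2_diff)
  have "\<bar>(u x - u y) * jump_kernel j x y\<bar> \<le> \<bar>jump_kernel j x y + (u x - u y)\<^sup>2 * jump_kernel j x y\<bar>"
    if "y \<in> D" for y
  proof -
    have k: "0 < jump_kernel j x y"
      using that D_disjoint_exterior[OF x] by (intro jump_kernel_pos) auto
    have "\<bar>(u x - u y) * jump_kernel j x y\<bar> = \<bar>u x - u y\<bar> * jump_kernel j x y"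
      using k by (simp add: abs_mult)
    also have "\<dots> \<le> (1 + (u x - u y)\<^sup>2) * jump_kernel j x y"
      using k by (intro mult_right_mono *) auto
    also have "\<dots> = jump_kernel j x y + (u x - u y)\<^sup>2 * jump_kernel j x y"
      by (simp add: distrib_right)
    finally show ?thesis
      by linarith
  qed
  then show "AE y in lborel. norm (indicator D y *\<^sub>R ((u x - u y) * jump_kernel j x y)) \<le>
      norm (indicator D y *\<^sub>R jump_kernel j x y + indicator D y *\<^sub>R ((u x - u y)\<^sup>2 * jump_kernel j x y))"
    by (intro AE_I2) (auto simp: indicator_def)
qed measurable

lemma normal_derivative_square_le:
  assumes u: "u \<in> borel_measurable borel" and x: "x \<in> - closure D"
    and sq: "set_integrable lborel D (\<lambda>y. (u x - u y)\<^sup>2 * jump_kernel j x y)"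
  shows "(LINT y:D|lborel. jump_kernel j x y) * (normal_derivative j D u x)\<^sup>2 \<le>
    (LINT y:D|lborel. (u x - u y)\<^sup>2 * jump_kernel j x y)"
proof -
  \<comment> \<open>\<open>c\<close> is the mean of \<open>u x - u y\<close> with respect to \<open>jump_kernel j x y dy\<close>; expand the variance.\<close>
  define c where "c = normal_derivative j D u x"
  have 1: "set_integrable lborel D (\<lambda>y. (2 * c) * ((u x - u y) * jump_kernel j x y))"
    using set_integrable_increment_kernel[OF u x sq] by (intro set_integrable_mult_right)
  have 2: "set_integrable lborel D (\<lambda>y. c\<^sup>2 * jump_kernel j x y)"
    using set_integrable_jump_kernel[OF x] by (intro set_integrable_mult_right)
  have "0 \<le> indicator D y *\<^sub>R ((u x - u y - c)\<^sup>2 * jump_kernel j x y)" for y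
    using D_disjoint_exterior[OF x] jump_kernel_pos[of x y]
    by (cases "x = y") (auto simp: indicator_def)
  then have "0 \<le> (LINT y:D|lborel. (u x - u y - c)\<^sup>2 * jump_kernel j x y)"
    unfolding set_lebesgue_integral_def by (intro integral_nonneg_AE) auto
  also have "\<dots> = (LINT y:D|lborel. (u x - u y)\<^sup>2 * jump_kernel j x y
      - (2 * c) * ((u x - u y) * jump_kernel j x y) + c\<^sup>2 * jump_kernel j x y)"
    by (simp add: power2_eq_square algebra_simps)
  also have "\<dots> = (LINT y:D|lborel. (u x - u y)\<^sup>2 * jump_kernel j x y)
      - 2 * c * (LINT y:D|lborel. (u x - u y) * jump_kernel j x y)
      + c\<^sup>2 * (LINT y:D|lborel. jump_kernel j x y)"
    using sq 1 2 by (simp add: set_integral_add set_integral_diff)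
  also have "(LINT y:D|lborel. (u x - u y) * jump_kernel j x y) = c * (LINT y:D|lborel. jump_kernel j x y)"
    unfolding c_def by (rule normal_derivative_mult_weight[OF x, symmetric])
  finally show ?thesis
    by (simp add: c_def power2_eq_square algebra_simps)
qed

section \<open>Square integrability of the normal derivative\<close>

lemma cross_weight_exterior:
  "x \<in> - closure D \<Longrightarrow> cross_weight (x, y) = indicator D y * jump_kernel j x y"
  using D_disjoint_exterior[of x] by (simp add: cross_weight_def)

text \<open>Fubini for the squared increments over mixed pairs, whose total integral is finite
  because the energy is. The second statement provides the integrable majorant for the squared
  normal derivative.\<close>

lemma
  assumes u: "u \<in> energy_space j D"
  shows AE_set_integrable_increment_square:
      "AE x in lborel. x \<in> - closure D \<longrightarrow> set_integrable lborel D (\<lambda>y. (u x - u y)\<^sup>2 * jump_kernel j x y)"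
    and integrable_cross_increment_square:
      "integrable lborel (\<lambda>x. LINT y|lborel. cross_weight (x, y) * (u x - u y)\<^sup>2)"
proof -
  have int: "integrable (lborel \<Otimes>\<^sub>M lborel) (\<lambda>p. cross_weight p * (increment u p)\<^sup>2)"
    using u by (intro integrable_cross_weight) (simp add: energy_space_iff)
  have "AE x in lborel. integrable lborel (\<lambda>y. cross_weight (x, y) * (u x - u y)\<^sup>2)"
    using lborel_pair.AE_integrable_fst'[OF int] by (simp add: increment_def)
  then show "AE x in lborel. x \<in> - closure D \<longrightarrow> set_integrable lborel D (\<lambda>y. (u x - u y)\<^sup>2 * jump_kernel j x y)"
    by eventually_elim (auto simp: set_integrable_def cross_weight_exterior mult_ac)
  show "integrable lborel (\<lambda>x. LINT y|lborel. cross_weight (x, y) * (u x - u y)\<^sup>2)"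
    using lborel_pair.integrable_fst'[OF int] by (simp add: increment_def)
qed

lemma normal_derivative_in_exterior_L2:
  assumes u: "u \<in> energy_space j D"
  shows "normal_derivative j D u \<in> exterior_L2 j D"
proof -
  have um [measurable]: "u \<in> borel_measurable borel"
    using u by (simp add: energy_space_iff)
  have "integrable lborel (\<lambda>x. exterior_density x * (normal_derivative j D u x)\<^sup>2)"
  proof (rule Bochner_Integration.integrable_bound[OF integrable_cross_increment_square[OF u]])
    show "AE x in lborel. norm (exterior_density x * (normal_derivative j D u x)\<^sup>2) \<le>
        norm (LINT y|lborel. cross_weight (x, y) * (u x - u y)\<^sup>2)"
      using AE_set_integrable_increment_square[OF u]
    proof eventually_elim
      case (elim x)
      show ?case
      proof (cases "x \<in> - closure D")
        case True
        then have "exterior_density x * (normal_derivative j D u x)\<^sup>2 \<le>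
            (LINT y:D|lborel. (u x - u y)\<^sup>2 * jump_kernel j x y)"
          using normal_derivative_square_le[OF um True] elim by (simp add: exterior_density_def)
        also have "\<dots> = (LINT y|lborel. cross_weight (x, y) * (u x - u y)\<^sup>2)"
          using True by (simp add: set_lebesgue_integral_def cross_weight_exterior mult_ac)
        finally show ?thesis
          using exterior_density_nonneg[of x] by (simp add: abs_mult)
      qed (simp add: exterior_density_def)
    qed
  qed simp
  moreover have "normal_derivative j D u x = 0" if "x \<in> D" for x
    using D_disjoint_exterior that by (auto simp: normal_derivative_def)
  ultimately show ?thesis
    by (simp add: exterior_L2_def integrable_exterior_measure_iff)
qed

text \<open>A nonlocal Gauss-Green formula for test functions supported outside \<open>D\<close>. On
  mixed pairs the increment of \<eta> is its value at the exterior point; it leaves the inner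
  integral, and what remains is the numerator of the normal derivative.\<close>

lemma energy_form_exterior:
  assumes u: "u \<in> energy_space j D" and \<eta>: "\<eta> \<in> exterior_L2 j D"
  shows "energy_form j D u \<eta> = exterior_inner j D (normal_derivative j D u) \<eta>"
proof -
  have um [measurable]: "u \<in> borel_measurable borel"
    using u by (simp add: energy_space_iff)
  have \<eta>m [measurable]: "\<eta> \<in> borel_measurable borel" and zero: "\<And>x. x \<in> D \<Longrightarrow> \<eta> x = 0"
    using \<eta> by (auto simp: exterior_L2_def)
  let ?h = "\<lambda>p. increment u p * increment \<eta> p"
  have int: "integrable (lborel \<Otimes>\<^sub>M lborel) (\<lambda>p. cross_weight p * ?h p)"
    by (intro integrable_cross_weight integrable_increment_mult u exterior_L2_subset_energy_space \<eta>)
  have "energy_form j D u \<eta> = 1 / 2 * (LINT p|energy_measure. ?h p)"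
    by (intro energy_form_eq) auto
  also have "(LINT p|energy_measure. ?h p) = 2 * (LINT p|(lborel \<Otimes>\<^sub>M lborel). cross_weight p * ?h p)"
    by (intro integral_energy_measure_cross int) (auto simp: increment_def algebra_simps zero)
  also have "(LINT p|(lborel \<Otimes>\<^sub>M lborel). cross_weight p * ?h p) =
      (LINT x|lborel. LINT y|lborel. cross_weight (x, y) * ?h (x, y))"
    by (rule lborel_pair.integral_fst'[OF int, symmetric])
  also have "\<dots> = (LINT x|lborel. exterior_density x * (normal_derivative j D u x * \<eta> x))"
  proof (rule integral_cong_AE)
    show "(\<lambda>x. LINT y|lborel. cross_weight (x, y) * ?h (x, y)) \<in> borel_measurable lborel"
      using lborel_pair.integrable_fst'[OF int] by (rule borel_measurable_integrable)
    show "AE x in lborel. (LINT y|lborel. cross_weight (x, y) * ?h (x, y)) =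
        exterior_density x * (normal_derivative j D u x * \<eta> x)"
      using AE_not_frontier
    proof eventually_elim
      case (elim x)
      show ?case
      proof (cases "x \<in> - closure D")
        case True
        have "(LINT y|lborel. cross_weight (x, y) * ?h (x, y)) =
            (LINT y|lborel. \<eta> x * (indicator D y *\<^sub>R ((u x - u y) * jump_kernel j x y)))"
          using True
          by (intro Bochner_Integration.integral_cong refl)
            (auto simp: cross_weight_exterior increment_def indicator_def zero)
        also have "\<dots> = \<eta> x * (LINT y:D|lborel. (u x - u y) * jump_kernel j x y)"
          by (simp add: set_lebesgue_integral_def)
        finally show ?thesis
          using True by (simp add: normal_derivative_mult_weight[symmetric] exterior_density_def)
      next
        case False
        then have "x \<in> D"
          using elim open_D by (auto simp: frontier_def interior_open)
        then show ?thesis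
          using False by (simp add: exterior_density_def cross_weight_def)
      qed
    qed
  qed measurable
  also have "\<dots> = exterior_inner j D (normal_derivative j D u) \<eta>"
    unfolding exterior_inner_def by (rule integral_exterior_measure[symmetric]) simp
  finally show ?thesis
    by simp
qed

section \<open>Identification of \<open>N\<close> with the normal derivative\<close>

lemma energy_form_add_right:
  assumes "u \<in> energy_space j D" "v \<in> energy_space j D" "w \<in> energy_space j D"
  shows "energy_form j D u (\<lambda>x. v x + w x) = energy_form j D u v + energy_form j D u w"
proof -
  have [measurable]: "u \<in> borel_measurable borel" "v \<in> borel_measurable borel" "w \<in> borel_measurable borel"
    using assms by (auto simp: energy_space_iff)
  show ?thesis
    using integrable_increment_mult[OF assms(1,2)] integrable_increment_mult[OF assms(1,3)]
    by (simp add: energy_form_eq increment_add distrib_left)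
qed

text \<open>The difference of \<open>v\<close> and \<eta> vanishes outside \<open>D\<close>, so it
  is a test function in the equation for \<open>u\<close>. This replaces the implicit
  \<open>v\<close> by the explicit extension by zero.\<close>

lemma energy_form_solutions:
  assumes u: "dirichlet_solution j D \<phi> u" and v: "dirichlet_solution j D \<eta> v"
    and \<eta>: "\<eta> \<in> exterior_L2 j D"
  shows "energy_form j D u v = energy_form j D u \<eta>"
proof -
  let ?w = "\<lambda>x. v x - \<eta> x"
  have w: "?w \<in> energy_space_zero j D" and uE: "u \<in> energy_space j D"
    and "energy_form j D u ?w = 0"
    using u v by (auto simp: dirichlet_solution_def)
  moreover have "energy_form j D u (\<lambda>x. \<eta> x + ?w x) = energy_form j D u \<eta> + energy_form j D u ?w"
    using w by (intro energy_form_add_right uE exterior_L2_subset_energy_space[OF \<eta>])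
      (simp add: energy_space_zero_def)
  ultimately show ?thesis
    by simp
qed

lemma exterior_L2_measurable: "\<eta> \<in> exterior_L2 j D \<Longrightarrow> \<eta> \<in> borel_measurable (exterior_measure j D)"
  by (simp add: exterior_L2_def exterior_measure_def)

lemma integrable_exterior_L2_mult:
  assumes "\<eta> \<in> exterior_L2 j D" "\<zeta> \<in> exterior_L2 j D"
  shows "integrable (exterior_measure j D) (\<lambda>x. \<eta> x * \<zeta> x)"
  using exterior_L2_measurable[OF assms(1)] exterior_L2_measurable[OF assms(2)] assms
  by (intro integrable_mult_of_squares) (simp_all add: exterior_L2_def)

lemma exterior_L2_diff:
  assumes "\<eta> \<in> exterior_L2 j D" "\<zeta> \<in> exterior_L2 j D"
  shows "(\<lambda>x. \<eta> x - \<zeta> x) \<in> exterior_L2 j D"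
proof -
  have "integrable (exterior_measure j D) (\<lambda>x. (\<eta> x + - \<zeta> x)\<^sup>2)"
    using exterior_L2_measurable[OF assms(1)] exterior_L2_measurable[OF assms(2)] assms
    by (intro integrable_square_add) (simp_all add: exterior_L2_def)
  then show ?thesis
    using assms by (simp add: exterior_L2_def borel_measurable_diff)
qed

lemma dirichlet_to_neumann_eq_normal_derivative:
  assumes N: "dirichlet_to_neumann j D N" and \<phi>: "\<phi> \<in> exterior_L2 j D"
    and u: "dirichlet_solution j D \<phi> u"
  shows "exterior_eq j D (N \<phi>) (normal_derivative j D u)"
proof -
  let ?n = "normal_derivative j D u"
  have uE: "u \<in> energy_space j D"
    using u by (simp add: dirichlet_solution_def)
  have "exterior_eq j D \<phi> \<phi>"
    using \<phi> by (simp add: exterior_eq_def)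
  then have "exterior_eq j D (N \<phi>) (N \<phi>)"
    using N unfolding dirichlet_to_neumann_def by blast
  then have N\<phi>: "N \<phi> \<in> exterior_L2 j D"
    by (simp add: exterior_eq_def)
  have n: "?n \<in> exterior_L2 j D"
    using uE by (rule normal_derivative_in_exterior_L2)
  define \<eta> where "\<eta> x = N \<phi> x - ?n x" for x
  have \<eta>: "\<eta> \<in> exterior_L2 j D"
    unfolding \<eta>_def[abs_def] by (intro exterior_L2_diff N\<phi> n)
  obtain v where v: "dirichlet_solution j D \<eta> v"
    using dirichlet_solution_exists[OF \<eta>] by blast
  have "exterior_inner j D (N \<phi>) \<eta> = energy_form j D u v"
    using N \<phi> \<eta> u v unfolding dirichlet_to_neumann_def by blast
  also have "\<dots> = exterior_inner j D ?n \<eta>"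
    using energy_form_solutions[OF u v \<eta>] energy_form_exterior[OF uE \<eta>] by simp
  finally have "exterior_inner j D (N \<phi>) \<eta> = exterior_inner j D ?n \<eta>" .
  \<comment> \<open>Both inner products are integrals of integrable functions, so their difference
    is the squared norm of \<eta>.\<close>
  then have "(LINT x|exterior_measure j D. (\<eta> x)\<^sup>2) = 0"
    using integrable_exterior_L2_mult[OF N\<phi> \<eta>] integrable_exterior_L2_mult[OF n \<eta>]
    by (simp add: exterior_inner_def \<eta>_def power2_eq_square left_diff_distrib)
  then have "AE x in exterior_measure j D. (\<eta> x)\<^sup>2 = 0"
    using \<eta> by (subst (asm) integral_nonneg_eq_0_iff_AE) (auto simp: exterior_L2_def)
  then show ?thesis
    using N\<phi> n by (auto simp: exterior_eq_def \<eta>_def)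
qed

end

theorem mainTheorem4:
  fixes j :: "real \<Rightarrow> real"
    and D :: "'a::euclidean_space set"
    and N :: "('a \<Rightarrow> real) \<Rightarrow> ('a \<Rightarrow> real)"
    and \<phi> u :: "'a \<Rightarrow> real"
  assumes "DIM('a) \<ge> 2"
    and "\<And>r. r > 0 \<Longrightarrow> j r > 0"
    and "\<And>r s. 0 < r \<Longrightarrow> r \<le> s \<Longrightarrow> j s \<le> j r"
    and "integrable lborel (\<lambda>x::'a. min 1 ((norm x)\<^sup>2) * j (norm x))"
    and "open D" and "bounded D" and "frontier D \<in> null_sets lborel"
    and "dirichlet_to_neumann j D N"
    and "\<phi> \<in> exterior_L2 j D"
    and "dirichlet_solution j D \<phi> u"
  shows "(AE x in exterior_measure j D.
            set_integrable lborel D (\<lambda>y. (u x - u y) * jump_kernel j x y)) \<and>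
         exterior_eq j D (N \<phi>) (normal_derivative j D u)"
proof -
  interpret dirichlet_setting j D
    using assms(2,3,5-7) by unfold_locales
  have u: "u \<in> energy_space j D"
    using assms(10) by (simp add: dirichlet_solution_def)
  then have "u \<in> borel_measurable borel"
    by (simp add: energy_space_iff)
  \<comment> \<open>A Bochner integral defaults to 0 when the integrand is not integrable; this
    shows that the numerator of the normal derivative is a genuine integral for almost every
    exterior point.\<close>
  then have "AE x in exterior_measure j D.
      set_integrable lborel D (\<lambda>y. (u x - u y) * jump_kernel j x y)"
    using AE_set_integrable_increment_square[OF u]
    by (intro AE_exterior_measureI) (auto intro: set_integrable_increment_kernel elim!: eventually_mono)
  then show ?thesis
    using dirichlet_to_neumann_eq_normal_derivative[OF assms(8-10)] by blast
qed

end
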